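(* Let $f:\mathbb{CP}^2\to\mathbb{CP}^2$ be the map defined geometrically from the tangent lines of the deltoid (see context). Then on $\mathbb{C}^2$ (embedded in $\mathbb{CP}^2$ by $(x,y)\mapsto[x:y:1]$) $f$ takes the form $$(x,y)\mapsto(y^2-2x,\;x^2-2y).$$ On $\mathbb{CP}^2$ this extends to $$[x:y:z]\mapsto[y^2-2xz:\;x^2-2yz:\;z^2].$$ On the line at infinity $L_\infty=\{z=0\}$, with coordinate $\zeta=y/x\in\mathbb{C}\cup\{\infty\}$, $f$ has the form $\zeta\mapsto 1/\zeta^2$.
   Context: $[a:b:c]^\vee$ denotes the line in $\mathbb{CP}^2$ with equation $ax+by+cz=0$. The (complex) deltoid $\mathcal{D}\subset\mathbb{CP}^2$ is the image of $\gamma:\mathbb{CP}^1\to\mathbb{CP}^2$, $\gamma(t)=[2t^3+1:2t+t^4:t^2]$, with $\gamma(\infty)=[0:1:0]$; its cusps are $\gamma(1),\gamma(\omega),\gamma(\omega^2)$, where $\omega=e^{2\pi i/3}$. The line tangent to $\mathcal{D}$ at $\gamma(t)$ is $\check\gamma(t)=[-t^2:t:t^3-1]^\vee$, with $\check\gamma(0)=\check\gamma(\infty)=[0:0:1]^\vee=L_\infty$. $\mathcal{D}^\vee=\{\check\gamma(t):t\in\mathbb{CP}^1\}$ is the set of tangent lines. In $\mathbb{C}^2$ the line $\check\gamma(t)$ ($t\in\mathbb{C}\setminus\{0\}$) has equation $t^3-t^2x+ty-1=0$. The map $\check f:\mathcal{D}^\vee\to\mathcal{D}^\vee$: if $L\in\mathcal{D}^\vee$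 is tangent to $\mathcal{D}$ at $\mathbf{x}$, then $\check f(L)$ is the unique element of $\mathcal{D}^\vee$ such that $\{L,\check f(L)\}$ is the full set of tangent lines to $\mathcal{D}$ passing through $\mathbf{x}$. Equivalently, $\check f(\check\gamma(t))=\check\gamma(1/t^2)$ for all $t\in\mathbb{CP}^1$. Geometric definition of $f$: given $\mathbf{x}=[x:y:z]\in\mathbb{CP}^2$, let $L_1,L_2,L_3$ be the three elements of $\mathcal{D}^\vee$ passing through $\mathbf{x}$, counted with multiplicity; that is, $L_i=\check\gamma(t_i)$ where $t_1,t_2,t_3\in\mathbb{CP}^1$ are the roots of $z(t^3-1)-xt^2+yt$, regarded as a polynomial of formal degree $3$ (with $\infty$ counted as a root when the degree drops). The lines $\check f(L_1),\check f(L_2),\check f(L_3)$ are concurrent, and $f(\mathbf{x})$ is defined to be their point of concurrency. In the cases where this does not determine a single point, $f$ is extended by continuity: $f([1:0:0])=[0:1:0]$, $f([0:1:0])=[1:0:0]$, and whenever $\check f(L_1)=\check f(L_2)=\check f(L_3)$ is the tangent line at a cusp of $\mathcal{D}$, $f(\mathbf{x})$ is that cusp. *)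

theory Defs
  imports "HOL-Analysis.Analysis" "HOL-Computational_Algebra.Polynomial"
begin

text \<open>The complex projective plane: nonzero vectors of \<open>complex ^ 3\<close> up to nonzero scalars.\<close>

definition proj_eq :: "complex ^ 3 \<Rightarrow> complex ^ 3 \<Rightarrow> bool" where
  "proj_eq u v \<longleftrightarrow> u \<noteq> 0 \<and> v \<noteq> 0 \<and> (\<exists>c. c \<noteq> 0 \<and> v = c *s u)"

lemma part_equivp_proj_eq: "part_equivp proj_eq"
proof (rule part_equivpI)
  show "\<exists>u. proj_eq u u"
    by (rule exI [of _ "axis 1 1"]) (auto simp: proj_eq_def axis_eq_0_iff intro!: exI [of _ 1])
  show "symp proj_eq"
  proof (rule sympI)
    fix u v assume "proj_eq u v"
    then obtain c where "u \<noteq> 0" "v \<noteq> 0" "c \<noteq> 0" "v = c *s u"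
      by (auto simp: proj_eq_def)
    then show "proj_eq v u"
      by (auto simp: proj_eq_def vector_smult_assoc intro!: exI [of _ "inverse c"])
  qed
  show "transp proj_eq"
  proof (rule transpI)
    fix u v w assume "proj_eq u v" "proj_eq v w"
    then obtain c d where "u \<noteq> 0" "w \<noteq> 0" "c \<noteq> 0" "d \<noteq> 0" "v = c *s u" "w = d *s v"
      by (auto simp: proj_eq_def)
    then show "proj_eq u w"
      by (auto simp: proj_eq_def vector_smult_assoc intro!: exI [of _ "d * c"])
  qed
qed

quotient_type cp2 = "complex ^ 3" / partial: proj_eq
  by (rule part_equivp_proj_eq)

text \<open>\<open>pt x y z\<close> is the point \<open>[x : y : z]\<close>; it is unspecified if all three coordinates vanish.\<close>

definition pt :: "complex \<Rightarrow> complex \<Rightarrow> complex \<Rightarrow> cp2" where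
  "pt x y z = abs_cp2 (vector [x, y, z])"

lift_definition on_line :: "complex \<Rightarrow> complex \<Rightarrow> complex \<Rightarrow> cp2 \<Rightarrow> bool" is
  "\<lambda>a b c v. a * v $ 1 + b * v $ 2 + c * v $ 3 = 0"
proof -
  fix a b c u v assume "proj_eq u v"
  then obtain k where k: "k \<noteq> 0" "v = k *s u" by (auto simp: proj_eq_def)
  have "a * v $ 1 + b * v $ 2 + c * v $ 3 = k * (a * u $ 1 + b * u $ 2 + c * u $ 3)"
    by (simp add: k algebra_simps)
  then show "(a * u $ 1 + b * u $ 2 + c * u $ 3 = 0) = (a * v $ 1 + b * v $ 2 + c * v $ 3 = 0)"
    using k by simp
qed

text \<open>\<open>dual_line a b c\<close> is the line \<open>[a : b : c]\<close> of the dual plane, as a set of points.\<close>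

definition dual_line :: "complex \<Rightarrow> complex \<Rightarrow> complex \<Rightarrow> cp2 set" where
  "dual_line a b c = {p. on_line a b c p}"

definition L_inf :: "cp2 set" where
  "L_inf = dual_line 0 0 1"

text \<open>The projective line as \<open>\<complex> \<union> {\<infinity>}\<close>.\<close>

datatype cp1 = Fin complex | Infty

text \<open>The deltoid is the range of \<open>deltoid_pt\<close>; its tangent line at \<open>deltoid_pt t\<close>
  is \<open>deltoid_tangent t\<close>.\<close>

fun deltoid_pt :: "cp1 \<Rightarrow> cp2" where
  "deltoid_pt (Fin t) = pt (2 * t ^ 3 + 1) (2 * t + t ^ 4) (t ^ 2)"
| "deltoid_pt Infty = pt 0 1 0"

fun deltoid_tangent :: "cp1 \<Rightarrow> cp2 set" where
  "deltoid_tangent (Fin t) = dual_line (- (t ^ 2)) t (t ^ 3 - 1)"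
| "deltoid_tangent Infty = dual_line 0 0 1"

definition deltoid_dual :: "cp2 set set" where
  "deltoid_dual = range deltoid_tangent"

definition tangent_at :: "cp2 set \<Rightarrow> cp2 \<Rightarrow> bool" where
  "tangent_at L p \<longleftrightarrow> (\<exists>t. p = deltoid_pt t \<and> L = deltoid_tangent t)"

definition cusp_params :: "cp1 set" where
  "cusp_params = (let \<omega> = exp (2 * of_real pi * \<i> / 3) in {Fin 1, Fin \<omega>, Fin (\<omega> ^ 2)})"

text \<open>The line at infinity is tangent at two points of the deltoid, \<open>[1 : 0 : 0]\<close> and
  \<open>[0 : 1 : 0]\<close>, so the condition below ranges over all points of tangency.\<close>

definition dual_map :: "cp2 set \<Rightarrow> cp2 set" where
  "dual_map L = (THE M. M \<in> deltoid_dual \<and>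
     (\<forall>p. tangent_at L p \<longrightarrow> {L, M} = {N \<in> deltoid_dual. p \<in> N}))"

text \<open>The parameters of the three tangent lines through \<open>[x : y : z]\<close>: the roots of
  \<open>z (t\<^sup>3 - 1) - x t\<^sup>2 + y t\<close> as a polynomial of formal degree 3, the missing roots being \<open>\<infinity>\<close>.\<close>

lift_definition tangent_params :: "cp2 \<Rightarrow> cp1 multiset" is
  "\<lambda>v. let q = [:- (v $ 3), v $ 2, - (v $ 1), v $ 3:]
       in image_mset Fin (proots q) + replicate_mset (3 - degree q) Infty"
proof -
  fix u v assume "proj_eq u v"
  then obtain k where k: "k \<noteq> 0" "v = k *s u" by (auto simp: proj_eq_def)
  have "[:- (v $ 3), v $ 2, - (v $ 1), v $ 3:] = smult k [:- (u $ 3), u $ 2, - (u $ 1), u $ 3:]"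
    by (simp add: k)
  then show "(let q = [:- (u $ 3), u $ 2, - (u $ 1), u $ 3:]
       in image_mset Fin (proots q) + replicate_mset (3 - degree q) Infty) =
      (let q = [:- (v $ 3), v $ 2, - (v $ 1), v $ 3:]
       in image_mset Fin (proots q) + replicate_mset (3 - degree q) Infty)"
    using k(1) by (simp only: Let_def proots_smult [OF k(1)] degree_smult_eq if_False)
qed

definition tangent_lines :: "cp2 \<Rightarrow> cp2 set multiset" where
  "tangent_lines p = image_mset deltoid_tangent (tangent_params p)"

definition concurrent_at :: "cp2 set multiset \<Rightarrow> cp2 \<Rightarrow> bool" where
  "concurrent_at Ms q \<longleftrightarrow> (\<forall>M \<in># Ms. q \<in> M)"

text \<open>The last three branches are the values obtained by continuity; in the last one, all
  three image lines coincide with the tangent line at a cusp, which is the value.\<close>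

definition deltoid_map :: "cp2 \<Rightarrow> cp2" where
  "deltoid_map p =
    (let Ms = image_mset dual_map (tangent_lines p) in
     if \<exists>!q. concurrent_at Ms q then THE q. concurrent_at Ms q
     else if p = pt 1 0 0 then pt 0 1 0
     else if p = pt 0 1 0 then pt 1 0 0
     else THE c. \<exists>t \<in> cusp_params. c = deltoid_pt t \<and> (\<forall>M \<in># Ms. M = deltoid_tangent t))"

text \<open>The coordinate \<open>\<zeta> = y / x\<close> on the line at infinity (only meaningful there).\<close>

lift_definition inf_coord :: "cp2 \<Rightarrow> cp1" is
  "\<lambda>v. if v $ 1 = 0 then Infty else Fin (v $ 2 / v $ 1)"
  by (auto simp: proj_eq_def)

fun inverse_square :: "cp1 \<Rightarrow> cp1" where
  "inverse_square (Fin z) = (if z = 0 then Infty else Fin (1 / z ^ 2))"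
| "inverse_square Infty = Fin 0"

end

theory Submission
  imports Defs "HOL-Computational_Algebra.Fundamental_Theorem_Algebra"
begin

text \<open>Parametrise a finite point \<open>[x : y : 1]\<close> by the parameters \<open>a, b, c\<close> of its three tangent
  lines, so that \<open>x\<close>, \<open>y\<close>, \<open>1\<close> are the elementary symmetric functions of \<open>a, b, c\<close>. The image lines
  have parameters \<open>1 / a\<^sup>2, 1 / b\<^sup>2, 1 / c\<^sup>2\<close>, whose elementary symmetric functions are
  \<open>y\<^sup>2 - 2 x\<close>, \<open>x\<^sup>2 - 2 y\<close> and \<open>1\<close>; hence the image lines meet in \<open>[y\<^sup>2 - 2 x : x\<^sup>2 - 2 y : 1]\<close>.
  If the three image lines coincide, their common parameter is a cube root of unity and the
  point is the corresponding cusp.\<close>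

section \<open>Homogeneous coordinates in the quotient\<close>

lemma proj_eq_refl: "v \<noteq> 0 \<Longrightarrow> proj_eq v v"
  by (auto simp: proj_eq_def intro!: exI [of _ 1])

lemma vector_3_eq_0_iff: "vector [x, y, z] = (0 :: complex ^ 3) \<longleftrightarrow> (x, y, z) = (0, 0, 0)"
  by (auto simp: vec_eq_iff forall_3)

lemma pt_eq_iff:
  assumes "(x, y, z) \<noteq> (0, 0, 0)" "(x', y', z') \<noteq> (0, 0, 0)"
  shows "pt x y z = pt x' y' z' \<longleftrightarrow> (\<exists>k. k \<noteq> 0 \<and> x' = k * x \<and> y' = k * y \<and> z' = k * z)"
proof -
  have "pt x y z = pt x' y' z' \<longleftrightarrow> proj_eq (vector [x, y, z]) (vector [x', y', z'])"
    unfolding pt_def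
    using Quotient3_rel [OF Quotient3_cp2, of "vector [x, y, z]" "vector [x', y', z']"] assms
    by (simp only: proj_eq_refl vector_3_eq_0_iff not_False_eq_True simp_thms)
  also have "\<dots> \<longleftrightarrow> (\<exists>k. k \<noteq> 0 \<and> x' = k * x \<and> y' = k * y \<and> z' = k * z)"
    using assms by (simp add: proj_eq_def vector_3_eq_0_iff) (simp add: vec_eq_iff forall_3)
  finally show ?thesis .
qed

lemma pt_cases:
  obtains x y z where "p = pt x y z" "(x, y, z) \<noteq> (0, 0, 0)"
proof -
  obtain v where v: "p = abs_cp2 v" "proj_eq v v"
    using Quotient3_abs_rep [OF Quotient3_cp2] Quotient3_rep_reflp [OF Quotient3_cp2] by metis
  have "v = vector [v $ 1, v $ 2, v $ 3]"
    by (simp add: vec_eq_iff forall_3)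
  moreover have "v \<noteq> 0"
    using v by (simp add: proj_eq_def)
  ultimately show thesis
    using that v unfolding pt_def by (metis vector_3_eq_0_iff)
qed

lemma mem_dual_line_pt:
  assumes "(x, y, z) \<noteq> (0, 0, 0)"
  shows "pt x y z \<in> dual_line a b c \<longleftrightarrow> a * x + b * y + c * z = 0"
proof -
  have "proj_eq (vector [x, y, z]) (vector [x, y, z])"
    using assms by (intro proj_eq_refl) (simp add: vector_3_eq_0_iff)
  then show ?thesis
    unfolding dual_line_def pt_def by (simp add: on_line.abs_eq)
qed

lemma inf_coord_pt:
  assumes "(x, y, z) \<noteq> (0, 0, 0)"
  shows "inf_coord (pt x y z) = (if x = 0 then Infty else Fin (y / x))"
proof -
  have "proj_eq (vector [x, y, z]) (vector [x, y, z])"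
    using assms by (intro proj_eq_refl) (simp add: vector_3_eq_0_iff)
  then show ?thesis
    unfolding pt_def by (simp add: inf_coord.abs_eq)
qed

lemma tangent_params_pt:
  assumes "(x, y, z) \<noteq> (0, 0, 0)"
  shows "tangent_params (pt x y z) = image_mset Fin (proots [:- z, y, - x, z:]) +
    replicate_mset (3 - degree [:- z, y, - x, z:]) Infty"
proof -
  have "proj_eq (vector [x, y, z]) (vector [x, y, z])"
    using assms by (intro proj_eq_refl) (simp add: vector_3_eq_0_iff)
  then show ?thesis
    unfolding pt_def by (simp add: tangent_params.abs_eq Let_def)
qed

section \<open>Tangent lines of the deltoid and the dual map\<close>

lemma mem_deltoid_tangent_pt:
  assumes "(x, y, z) \<noteq> (0, 0, 0)"
  shows "pt x y z \<in> deltoid_tangent (Fin t) \<longleftrightarrow> - (t ^ 2) * x + t * y + (t ^ 3 - 1) * z = 0"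
  using assms by (simp add: mem_dual_line_pt)

text \<open>The coefficient vectors differ only by a sign. From here on every tangent line can be
  given a finite parameter.\<close>

lemma deltoid_tangent_Infty: "deltoid_tangent Infty = deltoid_tangent (Fin 0)"
proof (rule set_eqI)
  fix p
  obtain x y z where "p = pt x y z" "(x, y, z) \<noteq> (0, 0, 0)"
    by (rule pt_cases)
  then show "p \<in> deltoid_tangent Infty \<longleftrightarrow> p \<in> deltoid_tangent (Fin 0)"
    by (simp add: mem_dual_line_pt)
qed

text \<open>The parameter is read off on the line at infinity: \<open>[1 : s : 0]\<close> lies on
  the tangent with parameter s. Exchanging the two lines gives t * (s - t) = 0 and s * (t - s) = 0;
  one equation alone would still allow t = 0 or s = 0.\<close>

lemma deltoid_tangent_Fin_inj:
  assumes "deltoid_tangent (Fin s) = deltoid_tangent (Fin t)"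
  shows "s = t"
proof -
  have "pt 1 s 0 \<in> deltoid_tangent (Fin t)"
    by (subst assms [symmetric], subst mem_deltoid_tangent_pt) (auto simp: power2_eq_square)
  moreover have "pt 1 t 0 \<in> deltoid_tangent (Fin s)"
    by (subst assms, subst mem_deltoid_tangent_pt) (auto simp: power2_eq_square)
  ultimately show ?thesis
    by (simp add: mem_deltoid_tangent_pt del: deltoid_tangent.simps)
       (auto simp: power2_eq_square)
qed

lemma deltoid_dual_eq: "deltoid_dual = range (\<lambda>t. deltoid_tangent (Fin t))"
  unfolding deltoid_dual_def
proof (intro antisym subsetI)
  fix L assume "L \<in> range deltoid_tangent"
  then obtain u where "L = deltoid_tangent u" by blast
  then show "L \<in> range (\<lambda>t. deltoid_tangent (Fin t))"
    by (cases u) (auto simp: deltoid_tangent_Infty simp del: deltoid_tangent.simps)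
qed blast

text \<open>The value \<open>1 / 0 = 0\<close> is the right one here, as both \<open>0\<close> and \<open>\<infinity>\<close> parametrise
  the line at infinity.\<close>

lemma deltoid_dual_through_deltoid_pt:
  "{N \<in> deltoid_dual. deltoid_pt (Fin t) \<in> N} =
    {deltoid_tangent (Fin t), deltoid_tangent (Fin (1 / t ^ 2))}"
proof -
  have "deltoid_pt (Fin t) \<in> deltoid_tangent (Fin s) \<longleftrightarrow> s = t \<or> s = 1 / t ^ 2" for s
  proof -
    have nz: "(2 * t ^ 3 + 1, 2 * t + t ^ 4, t ^ 2) \<noteq> (0, 0, 0)"
      by auto
    have "deltoid_pt (Fin t) \<in> deltoid_tangent (Fin s) \<longleftrightarrow>
        - (s ^ 2) * (2 * t ^ 3 + 1) + s * (2 * t + t ^ 4) + (s ^ 3 - 1) * t ^ 2 = 0"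
      unfolding deltoid_pt.simps by (rule mem_deltoid_tangent_pt [OF nz])
    \<comment> \<open>As a cubic in s this has t as a double root, because the line with parameter t
      is tangent at the point; the remaining factor carries the other tangent line.\<close>
    also have "- (s ^ 2) * (2 * t ^ 3 + 1) + s * (2 * t + t ^ 4) + (s ^ 3 - 1) * t ^ 2 =
        (s - t) ^ 2 * (s * t ^ 2 - 1)"
      by (simp add: algebra_simps power_numeral_reduce)
    also have "\<dots> = 0 \<longleftrightarrow> s = t \<or> s = 1 / t ^ 2"
      by (cases "t = 0") (auto simp: field_simps)
    finally show ?thesis .
  qed
  then show ?thesis
    by (auto simp: deltoid_dual_eq simp del: deltoid_tangent.simps deltoid_pt.simps)
qed

text \<open>By injectivity a tangent line determines its point of contact, except that the line at
  infinity has the two parameters 0 and \<open>Infty\<close>.\<close>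

lemma tangent_at_deltoid_tangent_iff:
  "tangent_at (deltoid_tangent (Fin t)) p \<longleftrightarrow> p = deltoid_pt (Fin t) \<or> t = 0 \<and> p = deltoid_pt Infty"
proof
  assume "tangent_at (deltoid_tangent (Fin t)) p"
  then obtain u where "p = deltoid_pt u" "deltoid_tangent (Fin t) = deltoid_tangent u"
    by (auto simp: tangent_at_def simp del: deltoid_tangent.simps deltoid_pt.simps)
  then show "p = deltoid_pt (Fin t) \<or> t = 0 \<and> p = deltoid_pt Infty"
    by (cases u) (metis deltoid_tangent_Fin_inj deltoid_tangent_Infty)+
next
  assume "p = deltoid_pt (Fin t) \<or> t = 0 \<and> p = deltoid_pt Infty"
  then show "tangent_at (deltoid_tangent (Fin t)) p"
    unfolding tangent_at_def using deltoid_tangent_Infty by metis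
qed

text \<open>This is the second contact point of the line at infinity. It imposes the same condition
  as the first one, so \<open>dual_map\<close> fixes that line.\<close>

lemma deltoid_dual_through_deltoid_pt_Infty:
  "{N \<in> deltoid_dual. deltoid_pt Infty \<in> N} = {deltoid_tangent (Fin 0)}"
proof -
  have "deltoid_pt Infty \<in> deltoid_tangent (Fin s) \<longleftrightarrow> s = 0" for s
    unfolding deltoid_pt.simps by (subst mem_deltoid_tangent_pt) auto
  then have "{s. deltoid_pt Infty \<in> deltoid_tangent (Fin s)} = {0}"
    by (simp only: singleton_conv)
  moreover have "{N \<in> deltoid_dual. deltoid_pt Infty \<in> N} =
      (\<lambda>s. deltoid_tangent (Fin s)) ` {s. deltoid_pt Infty \<in> deltoid_tangent (Fin s)}"
    unfolding deltoid_dual_eq by blast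
  ultimately show ?thesis
    by (simp only: image_insert image_empty)
qed

lemma dual_map_deltoid_tangent:
  "dual_map (deltoid_tangent (Fin t)) = deltoid_tangent (Fin (1 / t ^ 2))"
  unfolding dual_map_def
proof (rule the_equality)
  show "deltoid_tangent (Fin (1 / t ^ 2)) \<in> deltoid_dual \<and>
    (\<forall>p. tangent_at (deltoid_tangent (Fin t)) p \<longrightarrow>
      {deltoid_tangent (Fin t), deltoid_tangent (Fin (1 / t ^ 2))} = {N \<in> deltoid_dual. p \<in> N})"
    using deltoid_dual_through_deltoid_pt [of t] deltoid_dual_through_deltoid_pt_Infty
    by (auto simp: tangent_at_deltoid_tangent_iff deltoid_dual_def
        simp del: deltoid_tangent.simps deltoid_pt.simps)
next
  fix M
  assume "M \<in> deltoid_dual \<and> (\<forall>p. tangent_at (deltoid_tangent (Fin t)) p \<longrightarrow>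
    {deltoid_tangent (Fin t), M} = {N \<in> deltoid_dual. p \<in> N})"
  then have "{deltoid_tangent (Fin t), M} =
      {deltoid_tangent (Fin t), deltoid_tangent (Fin (1 / t ^ 2))}"
    using deltoid_dual_through_deltoid_pt tangent_at_deltoid_tangent_iff by metis
  \<comment> \<open>Two pairs sharing one element have equal second elements, also when the pair
    collapses to a single line, as at a cusp.\<close>
  then show "M = deltoid_tangent (Fin (1 / t ^ 2))"
    by (metis doubleton_eq_iff)
qed

section \<open>Roots of the cubic and intersections of tangent lines\<close>

lemma monic_cubic_roots:
  fixes x y z :: complex
  obtains a b c where "x = a + b + c" "y = a * b + b * c + c * a" "z = a * b * c"
    "proots [:- z, y, - x, 1:] = {#a, b, c#}"
proof -
  let ?q = "[:- z, y, - x, 1:]"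
  obtain A where A: "size A = degree ?q" "?q = smult (lead_coeff ?q) (\<Prod>r\<in>#A. [:- r, 1:])"
    using alg_closed_imp_factorization [of ?q] by auto
  have "size A = Suc (Suc (Suc 0))"
    using A(1) by simp
  then obtain a b c where abc: "A = {#a, b, c#}"
    by (metis size_eq_Suc_imp_eq_union size_add_mset Suc_inject size_eq_0_iff_empty)
  have q: "?q = [:- a, 1:] * ([:- b, 1:] * [:- c, 1:])"
    using A(2) abc by simp
  have "proots ?q = {#a, b, c#}"
    unfolding q by (simp add: proots_mult del: mult_pCons_left mult_pCons_right)
  \<comment> \<open>Vieta's relations, by comparing coefficients in the factorisation.\<close>
  moreover have "x = a + b + c \<and> y = a * b + b * c + c * a \<and> z = a * b * c"
    using q by (simp add: algebra_simps)
  ultimately show thesis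
    using that by blast
qed

text \<open>Relative to the affine point, each of the two lines becomes v - w * y = r * (u - w * x),
  with r its parameter. Two different slopes force both differences to vanish.\<close>

lemma deltoid_tangent_meet_affine:
  assumes "s \<noteq> s'"
    and q: "pt x y 1 \<in> deltoid_tangent (Fin s)" "pt x y 1 \<in> deltoid_tangent (Fin s')"
    and p: "p \<in> deltoid_tangent (Fin s)" "p \<in> deltoid_tangent (Fin s')"
  shows "p = pt x y 1"
proof -
  obtain u v w where uvw: "p = pt u v w" "(u, v, w) \<noteq> (0, 0, 0)"
    by (rule pt_cases)
  \<comment> \<open>Subtracting w times the equation for \<open>pt x y 1\<close> from the one for
    \<open>p\<close> removes the r ^ 3 - 1 term. The value r = 0 would put an affine point on the
    line at infinity.\<close>
  have on: "r * (v - w * y) = r * (r * (u - w * x))" and nz: "r \<noteq> 0"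
    if "pt x y 1 \<in> deltoid_tangent (Fin r)" "p \<in> deltoid_tangent (Fin r)" for r
  proof -
    have 1: "- (r ^ 2) * x + r * y + (r ^ 3 - 1) * 1 = 0"
      using that(1) by (subst (asm) mem_deltoid_tangent_pt) auto
    have 2: "- (r ^ 2) * u + r * v + (r ^ 3 - 1) * w = 0"
      using that(2) uvw mem_deltoid_tangent_pt by metis
    show "r \<noteq> 0"
      using 1 by auto
    show "r * (v - w * y) = r * (r * (u - w * x))"
      using 1 2 by algebra
  qed
  have eqs: "v - w * y = s * (u - w * x)" "v - w * y = s' * (u - w * x)"
    using on [OF q(1) p(1)] on [OF q(2) p(2)] nz [OF q(1) p(1)] nz [OF q(2) p(2)] by simp_all
  then have "(s - s') * (u - w * x) = 0"
    by algebra
  then have "u = w * x" "v = w * y"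
    using \<open>s \<noteq> s'\<close> eqs by auto
  then have "w \<noteq> 0"
    using uvw by auto
  with \<open>u = w * x\<close> \<open>v = w * y\<close> have "pt x y 1 = pt u v w"
    by (subst pt_eq_iff) auto
  then show ?thesis
    using uvw by simp
qed

lemma deltoid_tangent_meet_L_inf:
  assumes "p \<in> deltoid_tangent (Fin 0)" "p \<in> deltoid_tangent (Fin s)" "s \<noteq> 0"
  shows "p = pt 1 s 0"
proof -
  obtain u v w where uvw: "p = pt u v w" "(u, v, w) \<noteq> (0, 0, 0)"
    by (rule pt_cases)
  have "w = 0" "- (s ^ 2) * u + s * v + (s ^ 3 - 1) * w = 0"
    using assms(1,2) uvw by (auto simp: mem_dual_line_pt)
  then have "w = 0" "s * v = s * (s * u)"
    by (auto simp: power2_eq_square)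
  then have "w = 0" "v = s * u" "u \<noteq> 0"
    using \<open>s \<noteq> 0\<close> uvw by auto
  then have "pt 1 s 0 = pt u v w"
    by (subst pt_eq_iff) auto
  then show ?thesis
    using uvw by simp
qed

section \<open>The map on affine points\<close>

lemma deltoid_map_eqI:
  assumes "concurrent_at (image_mset dual_map (tangent_lines p)) q"
    and "\<And>r. concurrent_at (image_mset dual_map (tangent_lines p)) r \<Longrightarrow> r = q"
  shows "deltoid_map p = q"
proof -
  have "\<exists>!q. concurrent_at (image_mset dual_map (tangent_lines p)) q"
    using assms by blast
  moreover have "(THE q. concurrent_at (image_mset dual_map (tangent_lines p)) q) = q"
    using assms by (rule the_equality)
  ultimately show ?thesis
    unfolding deltoid_map_def Let_def by (simp only: if_True)
qed

text \<open>The number w is a primitive cube root of unity, so w ^ 2 + w + 1 = 0 and s ^ 3 - 1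
  splits into the factors for 1, w and w ^ 2.\<close>

lemma mem_cusp_params_iff: "Fin s \<in> cusp_params \<longleftrightarrow> s ^ 3 = 1"
proof -
  define w where "w = exp (2 * of_real pi * \<i> / 3)"
  have w: "w = cis (2 * pi / 3)"
    by (simp add: w_def cis_conv_exp mult_ac)
  have w3: "w ^ 3 = 1"
    unfolding w by (simp add: Complex.DeMoivre)
  have "w \<noteq> 1"
  proof
    assume "w = 1"
    then have "cos (2 * pi / 3) = 1"
      unfolding w by (metis cis.sel(1) one_complex.sel(1))
    then show False
      by (simp add: cos_120)
  qed
  moreover have "(w - 1) * (w ^ 2 + w + 1) = 0"
    using w3 by algebra
  ultimately have w2: "w ^ 2 + w + 1 = 0"
    by simp
  have "s ^ 3 - 1 = (s - 1) * (s - w) * (s - w ^ 2)"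
    using w2 w3 by algebra
  then show ?thesis
    unfolding cusp_params_def Let_def w_def [symmetric]
    by (metis cp1.inject(1) empty_iff insert_iff mult_eq_0_iff right_minus_eq)
qed

lemma deltoid_map_affine:
  "deltoid_map (pt x y 1) = pt (y ^ 2 - 2 * x) (x ^ 2 - 2 * y) 1"
proof -
  obtain a b c where abc: "x = a + b + c" "y = a * b + b * c + c * a" "1 = a * b * c"
      "proots [:- 1, y, - x, 1:] = {#a, b, c#}"
    by (rule monic_cubic_roots [of x y 1])
  define T where "T = (\<lambda>s. deltoid_tangent (Fin s))"
  define f where "f = pt (y ^ 2 - 2 * x) (x ^ 2 - 2 * y) 1"
  define Ms where "Ms = image_mset dual_map (tangent_lines (pt x y 1))"
  have nz: "a \<noteq> 0" "b \<noteq> 0" "c \<noteq> 0"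
    using abc(3) by auto
  have "tangent_params (pt x y 1) = {#Fin a, Fin b, Fin c#}"
    using abc(4) by (subst tangent_params_pt) auto
  then have Ms: "Ms = {#T (1 / a ^ 2), T (1 / b ^ 2), T (1 / c ^ 2)#}"
    by (simp add: Ms_def tangent_lines_def dual_map_deltoid_tangent T_def del: deltoid_tangent.simps)
  have f_on: "f \<in> T (1 / a ^ 2) \<and> f \<in> T (1 / b ^ 2) \<and> f \<in> T (1 / c ^ 2)"
  proof -
    have *: "f \<in> T (1 / t ^ 2)" if "t \<noteq> 0" "t ^ 3 - x * t ^ 2 + y * t - 1 = 0" for t
    proof -
      \<comment> \<open>Even and odd powers of t are separated in the cubic and then squared. This
        gives a cubic in t ^ 2, and division by t ^ 6 turns it into the tangent equation for the
        parameter 1 / t ^ 2.\<close>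
      have "(x * t ^ 2 + 1) ^ 2 = (t ^ 3 + y * t) ^ 2"
        using that(2) by algebra
      then have "- (y ^ 2 - 2 * x) * t ^ 2 + (x ^ 2 - 2 * y) * t ^ 4 + (1 - t ^ 6) = 0"
        by algebra
      then have "(- (y ^ 2 - 2 * x) * t ^ 2 + (x ^ 2 - 2 * y) * t ^ 4 + (1 - t ^ 6)) / t ^ 6 = 0"
        by simp
      also have "(- (y ^ 2 - 2 * x) * t ^ 2 + (x ^ 2 - 2 * y) * t ^ 4 + (1 - t ^ 6)) / t ^ 6 =
          - ((1 / t ^ 2) ^ 2) * (y ^ 2 - 2 * x) + 1 / t ^ 2 * (x ^ 2 - 2 * y) +
          ((1 / t ^ 2) ^ 3 - 1) * 1"
        using that(1) by (simp add: field_simps power_numeral_reduce)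
      finally show ?thesis
        unfolding f_def T_def by (subst mem_deltoid_tangent_pt) auto
    qed
    have "t ^ 3 - x * t ^ 2 + y * t - 1 = (t - a) * (t - b) * (t - c)" for t
      unfolding abc(1,2) abc(3) by (simp add: algebra_simps power_numeral_reduce)
    then show ?thesis
      using * nz by auto
  qed
  then have conc: "concurrent_at Ms f"
    by (auto simp: Ms concurrent_at_def)
  show ?thesis
  proof (cases "1 / a ^ 2 = 1 / b ^ 2 \<and> 1 / b ^ 2 = 1 / c ^ 2")
    case False
    \<comment> \<open>Two of the image lines differ, and these two alone already determine the
      point.\<close>
    have "r = f" if "concurrent_at Ms r" for r
    proof -
      have "r \<in> T (1 / a ^ 2)" "r \<in> T (1 / b ^ 2)" "r \<in> T (1 / c ^ 2)"
        using that by (auto simp: Ms concurrent_at_def)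
      then show ?thesis
        using False f_on deltoid_tangent_meet_affine unfolding T_def f_def by metis
    qed
    with conc show ?thesis
      unfolding Ms_def f_def by (intro deltoid_map_eqI)
  next
    case True
    define s where "s = 1 / a ^ 2"
    have s: "s = 1 / a ^ 2" "s = 1 / b ^ 2" "s = 1 / c ^ 2"
      using True s_def by auto
    have "s * a ^ 2 = 1"
      unfolding s(1) using nz by simp
    moreover have "s * b ^ 2 = 1"
      unfolding s(2) using nz by simp
    moreover have "s * c ^ 2 = 1"
      unfolding s(3) using nz by simp
    ultimately have sabc: "s * a ^ 2 = 1" "s * b ^ 2 = 1" "s * c ^ 2 = 1" .
    \<comment> \<open>The product of the three equations is s ^ 3 * (a * b * c) ^ 2 = 1, and a * b *
      c = 1.\<close>
    have s3: "s ^ 3 = 1"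
      using sabc abc(3) by algebra
    have "s \<noteq> 0"
      using sabc by auto
    have Ms': "Ms = {#T s, T s, T s#}"
      using Ms s by simp
    \<comment> \<open>The common image line contains a point at infinity besides the affine point
      \<open>f\<close>, so the cusp branch of \<open>deltoid_map\<close> is reached.\<close>
    have "\<not> (\<exists>!q. concurrent_at Ms q)"
    proof -
      have "pt 1 s 0 \<in> T s"
        unfolding T_def by (subst mem_deltoid_tangent_pt) (auto simp: power2_eq_square)
      then have "concurrent_at Ms (pt 1 s 0)"
        by (simp add: Ms' concurrent_at_def)
      moreover have "pt 1 s 0 \<noteq> f"
        unfolding f_def by (subst pt_eq_iff) auto
      ultimately show ?thesis
        using conc by blast
    qed
    moreover have "pt x y 1 \<noteq> pt 1 0 0" "pt x y 1 \<noteq> pt 0 1 0"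
      by (subst pt_eq_iff; simp)+
    moreover have "(THE c. \<exists>t\<in>cusp_params. c = deltoid_pt t \<and> (\<forall>M\<in>#Ms. M = deltoid_tangent t)) = f"
    proof (rule the_equality)
      \<comment> \<open>Since a * b * c = 1, the left side is 1 / a ^ 2 + 1 / b ^ 2 + 1 / c ^ 2.
        Likewise x ^ 2 - 2 * y is a ^ 2 + b ^ 2 + c ^ 2 = 3 / s, which is 3 * s ^ 2.\<close>
      have "y ^ 2 - 2 * x = 3 * s" 
        using sabc s3 abc(1-3) by algebra
      moreover have "x ^ 2 - 2 * y = 3 * s ^ 2" 
        using sabc s3 abc(1-3) by algebra
      \<comment> \<open>With s ^ 3 = 1 the cusp is \<open>[3 : 3 * s : s ^ 2]\<close>; multiplying
        by s gives last coordinate 1.\<close>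
      ultimately have "deltoid_pt (Fin s) = f"
        unfolding f_def deltoid_pt.simps using \<open>s \<noteq> 0\<close> s3
        by (subst pt_eq_iff) (auto intro!: exI [of _ s] simp: power_numeral_reduce)
      then show "\<exists>t\<in>cusp_params. f = deltoid_pt t \<and> (\<forall>M\<in>#Ms. M = deltoid_tangent t)"
        using s3 by (intro bexI [of _ "Fin s"]) (simp_all add: mem_cusp_params_iff Ms' T_def)
      fix p
      assume "\<exists>t\<in>cusp_params. p = deltoid_pt t \<and> (\<forall>M\<in>#Ms. M = deltoid_tangent t)"
      then obtain t where t: "t \<in> cusp_params" "p = deltoid_pt t" "T s = deltoid_tangent t"
        by (auto simp: Ms')
      then obtain r where "t = Fin r"
        by (auto simp: cusp_params_def Let_def)
      then show "p = f"
        using t \<open>deltoid_pt (Fin s) = f\<close> deltoid_tangent_Fin_inj unfolding T_def by metis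
    qed
    ultimately show ?thesis
      unfolding deltoid_map_def Let_def Ms_def f_def by simp
  qed
qed

section \<open>The map on the line at infinity\<close>

lemma deltoid_map_at_infinity:
  assumes "(x, y) \<noteq> (0, 0)"
  shows "deltoid_map (pt x y 0) = pt (y ^ 2) (x ^ 2) 0"
proof -
  define T where "T = (\<lambda>s. deltoid_tangent (Fin s))"
  define Ms where "Ms = image_mset dual_map (tangent_lines (pt x y 0))"
  \<comment> \<open>The cubic degenerates to t * (y - x * t), with roots 0 and y / x and the missing
    roots at infinity. If y = 0, then x / y = 0, which correctly yields the line at infinity as the
    only image line.\<close>
  have Ms: "set_mset Ms = {T 0, T ((x / y) ^ 2)}"
  proof (cases "x = 0")
    case True
    then have "y \<noteq> 0"
      using assms by simp
    have "proots [:0, y:] = proots (smult y [:0, 1:])"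
      by simp
    also have "\<dots> = {#0#}"
      using \<open>y \<noteq> 0\<close> by (simp del: smult_pCons)
    finally have "tangent_params (pt x y 0) = {#Fin 0, Infty, Infty#}"
      using True \<open>y \<noteq> 0\<close> by (subst tangent_params_pt) (auto simp: numeral_2_eq_2)
    then show ?thesis
      using True by (simp add: Ms_def tangent_lines_def deltoid_tangent_Infty
          dual_map_deltoid_tangent T_def del: deltoid_tangent.simps)
  next
    case False
    have "proots [:0, y, - x:] = proots (smult (- x) ([:0, 1:] * [:- (y / x), 1:]))"
      using False by simp
    also have "\<dots> = {#0, y / x#}"
      using False by (simp add: proots_mult del: mult_pCons_left mult_pCons_right smult_pCons)
    finally have "tangent_params (pt x y 0) = {#Fin 0, Fin (y / x), Infty#}"
      using False by (subst tangent_params_pt) auto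
    then show ?thesis
      by (simp add: Ms_def tangent_lines_def deltoid_tangent_Infty insert_commute
          dual_map_deltoid_tangent T_def power_divide del: deltoid_tangent.simps)
  qed
  show ?thesis
  proof (cases "x = 0 \<or> y = 0")
    case False
    define s where "s = (x / y) ^ 2"
    have "s \<noteq> 0"
      using False by (simp add: s_def)
    have eq: "pt (y ^ 2) (x ^ 2) 0 = pt 1 s 0"
      using False by (subst pt_eq_iff) (auto simp: s_def field_simps intro!: exI [of _ "1 / y ^ 2"])
    have "pt 1 s 0 \<in> T 0" "pt 1 s 0 \<in> T s"
      unfolding T_def by (subst mem_deltoid_tangent_pt; simp add: power2_eq_square)+
    moreover have conc_iff: "concurrent_at Ms r \<longleftrightarrow> r \<in> T 0 \<and> r \<in> T s" for r
      by (simp add: concurrent_at_def Ms s_def)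
    ultimately have "concurrent_at Ms (pt 1 s 0)"
      by blast
    moreover have "r = pt 1 s 0" if "concurrent_at Ms r" for r
      using that deltoid_tangent_meet_L_inf [OF _ _ \<open>s \<noteq> 0\<close>] conc_iff unfolding T_def by blast
    ultimately show ?thesis
      unfolding eq Ms_def by (intro deltoid_map_eqI)
  next
    case True
    \<comment> \<open>Every image line is now the line at infinity. Two of its points show that
      concurrency fixes no single point, so the prescribed values at \<open>[1 : 0 : 0]\<close> and
      \<open>[0 : 1 : 0]\<close> apply.\<close>
    have "pt 1 0 0 \<in> T 0" "pt 0 1 0 \<in> T 0"
      unfolding T_def by (subst mem_deltoid_tangent_pt; simp)+
    moreover have "set_mset Ms = {T 0}"
      using True Ms by auto
    ultimately have "concurrent_at Ms (pt 1 0 0)" "concurrent_at Ms (pt 0 1 0)"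
      by (simp_all add: concurrent_at_def)
    moreover have ne: "pt 1 0 0 \<noteq> pt 0 1 0"
      by (subst pt_eq_iff) auto
    ultimately have nuniq: "\<not> (\<exists>!q. concurrent_at Ms q)"
      by blast
    have scale: "pt u 0 0 = pt 1 0 0" "pt 0 u 0 = pt 0 1 0" if "u \<noteq> 0" for u
      using that by (subst pt_eq_iff; auto intro!: exI [of _ "1 / u"])+
    have "pt x y 0 = pt 1 0 0 \<and> pt (y ^ 2) (x ^ 2) 0 = pt 0 1 0 \<or>
        pt x y 0 = pt 0 1 0 \<and> pt (y ^ 2) (x ^ 2) 0 = pt 1 0 0"
      using True assms scale [of x] scale [of y] scale [of "x ^ 2"] scale [of "y ^ 2"]
      by (cases "x = 0") simp_all
    then show ?thesis
      using nuniq ne unfolding deltoid_map_def Let_def Ms_def by auto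
  qed
qed

section \<open>The homogeneous formula on the whole plane\<close>

lemma deltoid_map_pt:
  assumes "(x, y, z) \<noteq> (0, 0, 0)"
  shows "deltoid_map (pt x y z) = pt (y ^ 2 - 2 * x * z) (x ^ 2 - 2 * y * z) (z ^ 2)"
proof (cases "z = 0")
  case True
  then show ?thesis
    using assms by (simp add: deltoid_map_at_infinity)
next
  case False
  \<comment> \<open>For nonzero z the point is normalised to last coordinate 1. The formula is
    homogeneous of degree 2, hence the factor z ^ 2 when clearing denominators.\<close>
  have "pt x y z = pt (x / z) (y / z) 1"
    using False by (subst pt_eq_iff) (auto intro!: exI [of _ "1 / z"])
  moreover have "pt ((y / z) ^ 2 - 2 * (x / z)) ((x / z) ^ 2 - 2 * (y / z)) 1 =
      pt (y ^ 2 - 2 * x * z) (x ^ 2 - 2 * y * z) (z ^ 2)"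
    using False
    by (subst pt_eq_iff) (auto intro!: exI [of _ "z ^ 2"] simp: field_simps power2_eq_square)
  ultimately show ?thesis
    by (simp add: deltoid_map_affine)
qed

theorem proposition2:
  shows "(\<forall>x y. deltoid_map (pt x y 1) = pt (y ^ 2 - 2 * x) (x ^ 2 - 2 * y) 1)
    \<and> (\<forall>x y z. (x, y, z) \<noteq> (0, 0, 0) \<longrightarrow>
          (y ^ 2 - 2 * x * z, x ^ 2 - 2 * y * z, z ^ 2) \<noteq> (0, 0, 0)
          \<and> deltoid_map (pt x y z) = pt (y ^ 2 - 2 * x * z) (x ^ 2 - 2 * y * z) (z ^ 2))
    \<and> (\<forall>p \<in> L_inf. deltoid_map p \<in> L_inf
          \<and> inf_coord (deltoid_map p) = inverse_square (inf_coord p))"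
proof (intro conjI allI impI ballI)
  fix p assume "p \<in> L_inf"
  obtain x y z where xyz: "p = pt x y z" "(x, y, z) \<noteq> (0, 0, 0)"
    by (rule pt_cases)
  with \<open>p \<in> L_inf\<close> have z: "z = 0"
    by (simp add: L_inf_def mem_dual_line_pt)
  with xyz have f: "deltoid_map p = pt (y ^ 2) (x ^ 2) 0" and nz: "(y ^ 2, x ^ 2, 0) \<noteq> (0, 0, 0)"
    by (auto simp: deltoid_map_at_infinity)
  show "deltoid_map p \<in> L_inf"
    unfolding f L_inf_def using nz by (subst mem_dual_line_pt) auto
  show "inf_coord (deltoid_map p) = inverse_square (inf_coord p)"
    \<comment> \<open>The coordinate of the image is x ^ 2 / y ^ 2, the inverse square of y / x. The
      cases x = 0 and y = 0 are the exchange of infinity and 0.\<close>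
    unfolding f inf_coord_pt [OF nz] unfolding xyz(1) inf_coord_pt [OF xyz(2)]
    using xyz z by (auto simp: power_divide)
next
  fix x y z :: complex
  assume "(x, y, z) \<noteq> (0, 0, 0)"
  then show "(y ^ 2 - 2 * x * z, x ^ 2 - 2 * y * z, z ^ 2) \<noteq> (0, 0, 0)"
    by auto
qed (simp_all only: deltoid_map_affine deltoid_map_pt not_False_eq_True)

end
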